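(* Let $n\ge 2$ and let $K$ be the set of regular elements of the additive semigroup $(A^+(B_n),+)$. Then $(K,+)$ is an inverse semigroup (in particular, $K$ is closed under $+$).
   Context: For $n\ge 1$ let $[n]=\{1,\dots,n\}$. The Brandt semigroup $(B_n,+)$ has underlying set $B_n=([n]\times[n])\cup\{\vartheta\}$ with $(i,j)+(k,l)=(i,l)$ if $j=k$, $(i,j)+(k,l)=\vartheta$ if $j\ne k$, and $\alpha+\vartheta=\vartheta+\alpha=\vartheta$ for all $\alpha\in B_n$. $M(B_n)$ is the set of all maps $B_n\to B_n$; arguments are written on the left of functions. It carries pointwise addition $\alpha(f+g)=\alpha f+\alpha g$ and composition $\alpha(f\circ g)=(\alpha f)g$. An affine map over $B_n$ is a map of the form $g+h$ with $g$ an endomorphism of the semigroup $(B_n,+)$ (not required to fix $\vartheta$) and $h\in M(B_n)$ a constant map. $A^+(B_n)$ (the affine near-semiring over $B_n$) is the smallest subset of $M(B_n)$ that contains all affine maps and is closed under $+$ and $\circ$. An element $f$ of $(A^+(B_n),+)$ is regular if $f+g+f=f$ for some $g\in A^+(B_n)$. *)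

theory Defs
  imports Main "HOL-Library.FuncSet"
begin

definition semigroup_on :: "'a set \<Rightarrow> ('a \<Rightarrow> 'a \<Rightarrow> 'a) \<Rightarrow> bool" where
  "semigroup_on S f \<longleftrightarrow>
     S \<noteq> {} \<and>
     (\<forall>x\<in>S. \<forall>y\<in>S. f x y \<in> S) \<and>
     (\<forall>x\<in>S. \<forall>y\<in>S. \<forall>z\<in>S. f (f x y) z = f x (f y z))"

definition regular_elements :: "'a set \<Rightarrow> ('a \<Rightarrow> 'a \<Rightarrow> 'a) \<Rightarrow> 'a set" where
  "regular_elements S f = {x \<in> S. \<exists>y\<in>S. f (f x y) x = x}"

definition inverse_semigroup :: "'a set \<Rightarrow> ('a \<Rightarrow> 'a \<Rightarrow> 'a) \<Rightarrow> bool" where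
  "inverse_semigroup S f \<longleftrightarrow>
     semigroup_on S f \<and>
     (\<forall>x\<in>S. \<exists>!y. y \<in> S \<and> f (f x y) x = x \<and> f (f y x) y = y)"

datatype brandt = Pair_elem nat nat | Theta  ("\<vartheta>")

definition brandt_set :: "nat \<Rightarrow> brandt set" where
  "brandt_set n = {Pair_elem i j | i j. i \<in> {1..n} \<and> j \<in> {1..n}} \<union> {\<vartheta>}"

fun brandt_add :: "brandt \<Rightarrow> brandt \<Rightarrow> brandt"  (infixl "\<oplus>\<^sub>B" 65) where
  "Pair_elem i j \<oplus>\<^sub>B Pair_elem k l = (if j = k then Pair_elem i l else \<vartheta>)"
| "\<vartheta> \<oplus>\<^sub>B b = \<vartheta>"
| "a \<oplus>\<^sub>B \<vartheta> = \<vartheta>"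

text \<open>Maps are extensional functions, i.e. \<^const>\<open>undefined\<close> outside \<open>brandt_set n\<close>, so that
  equality of maps is equality on \<open>brandt_set n\<close>.\<close>

definition brandt_maps :: "nat \<Rightarrow> (brandt \<Rightarrow> brandt) set" where
  "brandt_maps n = brandt_set n \<rightarrow>\<^sub>E brandt_set n"

definition bmap_add :: "nat \<Rightarrow> (brandt \<Rightarrow> brandt) \<Rightarrow> (brandt \<Rightarrow> brandt) \<Rightarrow> (brandt \<Rightarrow> brandt)" where
  "bmap_add n f g = (\<lambda>a\<in>brandt_set n. f a \<oplus>\<^sub>B g a)"

text \<open>Arguments are written on the left of maps in the source, so \<open>bmap_comp n f g\<close> applies \<open>f\<close>
  first and then \<open>g\<close>.\<close>

definition bmap_comp :: "nat \<Rightarrow> (brandt \<Rightarrow> brandt) \<Rightarrow> (brandt \<Rightarrow> brandt) \<Rightarrow> (brandt \<Rightarrow> brandt)" where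
  "bmap_comp n f g = compose (brandt_set n) g f"

definition brandt_endomorphisms :: "nat \<Rightarrow> (brandt \<Rightarrow> brandt) set" where
  "brandt_endomorphisms n =
     {g \<in> brandt_maps n. \<forall>a\<in>brandt_set n. \<forall>b\<in>brandt_set n. g (a \<oplus>\<^sub>B b) = g a \<oplus>\<^sub>B g b}"

definition constant_maps :: "nat \<Rightarrow> (brandt \<Rightarrow> brandt) set" where
  "constant_maps n = {h \<in> brandt_maps n. \<exists>c\<in>brandt_set n. \<forall>a\<in>brandt_set n. h a = c}"

definition affine_maps :: "nat \<Rightarrow> (brandt \<Rightarrow> brandt) set" where
  "affine_maps n =
     {bmap_add n g h | g h. g \<in> brandt_endomorphisms n \<and> h \<in> constant_maps n}"

inductive_set affine_near_semiring :: "nat \<Rightarrow> (brandt \<Rightarrow> brandt) set" for n :: nat where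
  affine: "f \<in> affine_maps n \<Longrightarrow> f \<in> affine_near_semiring n"
| add: "f \<in> affine_near_semiring n \<Longrightarrow> g \<in> affine_near_semiring n
    \<Longrightarrow> bmap_add n f g \<in> affine_near_semiring n"
| comp: "f \<in> affine_near_semiring n \<Longrightarrow> g \<in> affine_near_semiring n
    \<Longrightarrow> bmap_comp n f g \<in> affine_near_semiring n"

end

theory Submission
  imports Defs
begin

text \<open>Addition in \<open>A\<^sup>+(B\<^sub>n)\<close> is pointwise and \<open>B\<^sub>n\<close> is an inverse semigroup, so inverses are
  unique as soon as they exist. Every element of \<open>A\<^sup>+(B\<^sub>n)\<close> is either constant or maps injectively,
  on its support, from one column \<open>{(i, k) | i}\<close> into one column \<open>{(m, p) | m}\<close>. The pointwise
  inverse of a map of the second kind with two support points takes values in two different columns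
  and so cannot belong to \<open>A\<^sup>+(B\<^sub>n)\<close>. Hence a regular element is constant or has at most one support
  point; such maps are closed under addition, and they do have inverses, because adding suitable
  constant maps on both sides turns a value \<open>(k, l)\<close> into \<open>(l, k)\<close>.\<close>

section \<open>Arithmetic of the Brandt semigroup\<close>

lemma brandt_add_Theta [simp]: "a \<oplus>\<^sub>B \<vartheta> = \<vartheta>"
  by (cases a) auto

lemma brandt_add_assoc: "a \<oplus>\<^sub>B b \<oplus>\<^sub>B c = a \<oplus>\<^sub>B (b \<oplus>\<^sub>B c)"
  by (cases a; cases b; cases c) auto

lemma brandt_add_eq_Pair_elem_iff:
  "a \<oplus>\<^sub>B b = Pair_elem i l \<longleftrightarrow> (\<exists>j. a = Pair_elem i j \<and> b = Pair_elem j l)"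
  by (cases a; cases b) auto

text \<open>At a nonzero element a single equation already determines \<open>b\<close>, so values of
  endomorphisms and of additive inverses can be read off argument by argument.\<close>

lemma brandt_inverse_Pair_elem:
  "Pair_elem i j \<oplus>\<^sub>B b \<oplus>\<^sub>B Pair_elem i j = Pair_elem i j \<longleftrightarrow> b = Pair_elem j i"
  by (cases b) auto

text \<open>For nonzero \<open>a\<close> the first equation of each pair decides. For
  \<open>a\<close> = \<vartheta> it is the second one, whose left side collapses to
  \<vartheta>.\<close>

lemma brandt_inverse_unique:
  assumes "a \<oplus>\<^sub>B b \<oplus>\<^sub>B a = a" "b \<oplus>\<^sub>B a \<oplus>\<^sub>B b = b" "a \<oplus>\<^sub>B c \<oplus>\<^sub>B a = a" "c \<oplus>\<^sub>B a \<oplus>\<^sub>B c = c"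
  shows "b = c"
  using assms by (cases a) (auto simp: brandt_inverse_Pair_elem)

section \<open>Carrier sets and pointwise operations on maps\<close>

lemma Theta_in_brandt_set [simp]: "\<vartheta> \<in> brandt_set n"
  by (simp add: brandt_set_def)

lemma Pair_elem_in_brandt_set [simp]:
  "Pair_elem i j \<in> brandt_set n \<longleftrightarrow> i \<in> {1..n} \<and> j \<in> {1..n}"
  by (auto simp: brandt_set_def)

lemma brandt_add_in_brandt_set:
  "a \<in> brandt_set n \<Longrightarrow> b \<in> brandt_set n \<Longrightarrow> a \<oplus>\<^sub>B b \<in> brandt_set n"
  by (cases a; cases b) auto

lemma brandt_maps_eqI:
  "f \<in> brandt_maps n \<Longrightarrow> g \<in> brandt_maps n \<Longrightarrow> (\<And>a. a \<in> brandt_set n \<Longrightarrow> f a = g a) \<Longrightarrow> f = g"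
  unfolding brandt_maps_def by (rule PiE_ext)

lemma brandt_maps_apply: "f \<in> brandt_maps n \<Longrightarrow> a \<in> brandt_set n \<Longrightarrow> f a \<in> brandt_set n"
  by (auto simp: brandt_maps_def)

lemma bmap_add_apply [simp]: "a \<in> brandt_set n \<Longrightarrow> bmap_add n f g a = f a \<oplus>\<^sub>B g a"
  by (simp add: bmap_add_def)

lemma bmap_comp_apply [simp]: "a \<in> brandt_set n \<Longrightarrow> bmap_comp n f g a = g (f a)"
  by (simp add: bmap_comp_def compose_def)

lemma bmap_add_in_brandt_maps:
  "f \<in> brandt_maps n \<Longrightarrow> g \<in> brandt_maps n \<Longrightarrow> bmap_add n f g \<in> brandt_maps n"
  by (auto simp: brandt_maps_def bmap_add_def intro!: brandt_add_in_brandt_set)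

lemma bmap_comp_in_brandt_maps:
  "f \<in> brandt_maps n \<Longrightarrow> g \<in> brandt_maps n \<Longrightarrow> bmap_comp n f g \<in> brandt_maps n"
  by (auto simp: brandt_maps_def bmap_comp_def compose_def)

lemma bmap_add_assoc: "bmap_add n (bmap_add n f g) h = bmap_add n f (bmap_add n g h)"
  by (auto simp: bmap_add_def brandt_add_assoc restrict_def)

lemma affine_near_semiring_in_brandt_maps:
  "f \<in> affine_near_semiring n \<Longrightarrow> f \<in> brandt_maps n"
proof (induction rule: affine_near_semiring.induct)
  case (affine f)
  then show ?case
    by (auto simp: affine_maps_def brandt_endomorphisms_def constant_maps_def
        intro: bmap_add_in_brandt_maps)
qed (simp_all add: bmap_add_in_brandt_maps bmap_comp_in_brandt_maps)

section \<open>Shapes of maps\<close>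

definition constant_on_brandt :: "nat \<Rightarrow> (brandt \<Rightarrow> brandt) \<Rightarrow> bool" where
  "constant_on_brandt n f \<longleftrightarrow> (\<exists>c\<in>brandt_set n. \<forall>a\<in>brandt_set n. f a = c)"

text \<open>Since all nonzero values share the column \<open>p\<close>, injectivity means that
  distinct support points take values with distinct first coordinates; the regularity argument rests
  on this. The zero map qualifies with any \<open>k\<close> and \<open>p\<close>.\<close>

definition column_map :: "nat \<Rightarrow> (brandt \<Rightarrow> brandt) \<Rightarrow> bool" where
  "column_map n f \<longleftrightarrow>
     (\<exists>k p. \<forall>a\<in>brandt_set n. f a \<noteq> \<vartheta> \<longrightarrow> (\<exists>i m. a = Pair_elem i k \<and> f a = Pair_elem m p)) \<and>
     inj_on f {a \<in> brandt_set n. f a \<noteq> \<vartheta>}"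

definition support_subsingleton :: "nat \<Rightarrow> (brandt \<Rightarrow> brandt) \<Rightarrow> bool" where
  "support_subsingleton n f \<longleftrightarrow>
     (\<forall>a\<in>brandt_set n. \<forall>b\<in>brandt_set n. f a \<noteq> \<vartheta> \<longrightarrow> f b \<noteq> \<vartheta> \<longrightarrow> a = b)"

lemma column_mapI:
  assumes "\<And>a. a \<in> brandt_set n \<Longrightarrow> f a \<noteq> \<vartheta> \<Longrightarrow> \<exists>i m. a = Pair_elem i k \<and> f a = Pair_elem m p"
    and "\<And>i j m. Pair_elem i k \<in> brandt_set n \<Longrightarrow> Pair_elem j k \<in> brandt_set n \<Longrightarrow>
      f (Pair_elem i k) = Pair_elem m p \<Longrightarrow> f (Pair_elem j k) = Pair_elem m p \<Longrightarrow> i = j"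
  shows "column_map n f"
  unfolding column_map_def
proof
  show "inj_on f {a \<in> brandt_set n. f a \<noteq> \<vartheta>}"
  proof (rule inj_onI, clarify)
    fix a b
    assume a: "a \<in> brandt_set n" "f a \<noteq> \<vartheta>" and b: "b \<in> brandt_set n" "f b \<noteq> \<vartheta>" and "f a = f b"
    then show "a = b"
      using assms(1)[OF a] assms(1)[OF b] assms(2) by auto
  qed
qed (use assms(1) in blast)

lemma column_mapE:
  assumes "column_map n f"
  obtains k p where
    "\<And>a. a \<in> brandt_set n \<Longrightarrow> f a \<noteq> \<vartheta> \<Longrightarrow> \<exists>i m. a = Pair_elem i k \<and> f a = Pair_elem m p"
    "\<And>a b. a \<in> brandt_set n \<Longrightarrow> b \<in> brandt_set n \<Longrightarrow> f a \<noteq> \<vartheta> \<Longrightarrow> f a = f b \<Longrightarrow> a = b"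
  using assms unfolding column_map_def inj_on_def by (metis (mono_tags, lifting) mem_Collect_eq)

section \<open>Constants, endomorphisms and affine maps\<close>

lemma constant_map_in_affine_near_semiring:
  assumes "c \<in> brandt_set n"
  shows "(\<lambda>a\<in>brandt_set n. c) \<in> affine_near_semiring n"
proof -
  \<comment> \<open>The constant map with an idempotent value is an endomorphism. An idempotent
    \<open>e\<close> that is a left identity for \<open>c\<close> thus exhibits the constant
    \<open>c\<close> as an affine map.\<close>
  obtain e where e: "e \<in> brandt_set n" "e \<oplus>\<^sub>B e = e" "e \<oplus>\<^sub>B c = c"
  proof (cases c)
    case (Pair_elem i j)
    then show thesis using assms that[of "Pair_elem i i"] by simp
  qed (use that[of \<vartheta>] in simp)
  have "(\<lambda>a\<in>brandt_set n. e) \<in> brandt_endomorphisms n"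
    using e by (auto simp: brandt_endomorphisms_def brandt_maps_def brandt_add_in_brandt_set)
  moreover have "(\<lambda>a\<in>brandt_set n. c) \<in> constant_maps n"
    using assms by (auto simp: constant_maps_def brandt_maps_def)
  moreover have "(\<lambda>a\<in>brandt_set n. c) = bmap_add n (\<lambda>a\<in>brandt_set n. e) (\<lambda>a\<in>brandt_set n. c)"
    using e by (auto simp: bmap_add_def restrict_def)
  ultimately show ?thesis
    by (intro affine_near_semiring.affine) (auto simp: affine_maps_def)
qed

text \<open>The value \<open>g \<vartheta>\<close> is idempotent, hence some (r, r). As \<vartheta>
  absorbs \<open>a\<close>, the sum (r, r) + \<open>g a\<close> is again (r, r), which forces
  \<open>g a\<close> = (r, r).\<close>

lemma brandt_endomorphism_constant:
  assumes "g \<in> brandt_endomorphisms n" "g \<vartheta> \<noteq> \<vartheta>" "a \<in> brandt_set n"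
  shows "g a = g \<vartheta>"
proof -
  have "g (\<vartheta> \<oplus>\<^sub>B \<vartheta>) = g \<vartheta> \<oplus>\<^sub>B g \<vartheta>" "g (\<vartheta> \<oplus>\<^sub>B a) = g \<vartheta> \<oplus>\<^sub>B g a" "g (a \<oplus>\<^sub>B \<vartheta>) = g a \<oplus>\<^sub>B g \<vartheta>"
    \<comment> \<open>The addition rules are withheld so that the arguments remain sums, to which
      the homomorphism law applies.\<close>
    using assms by (auto simp: brandt_endomorphisms_def simp del: brandt_add.simps brandt_add_Theta)
  then show ?thesis
    using assms(2) by (cases "g \<vartheta>"; cases "g a") (auto split: if_splits)
qed

text \<open>Homomorphisms preserve inverses: apply \<open>g\<close> to (i, j) + (j, i) + (i, j) =
  (i, j) and use that only (p, m) inverts (m, p).\<close>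

lemma brandt_endomorphism_swap:
  assumes "g \<in> brandt_endomorphisms n" "Pair_elem i j \<in> brandt_set n"
    and "g (Pair_elem i j) = Pair_elem m p"
  shows "g (Pair_elem j i) = Pair_elem p m"
proof -
  have hom: "g (a \<oplus>\<^sub>B b) = g a \<oplus>\<^sub>B g b" if "a \<in> brandt_set n" "b \<in> brandt_set n" for a b
    using assms(1) that by (auto simp: brandt_endomorphisms_def)
  have "g (Pair_elem i j \<oplus>\<^sub>B Pair_elem j i \<oplus>\<^sub>B Pair_elem i j)
      = g (Pair_elem i j) \<oplus>\<^sub>B g (Pair_elem j i) \<oplus>\<^sub>B g (Pair_elem i j)"
    using assms(2) by (subst hom hom; simp add: hom[symmetric])
  then show ?thesis
    using assms(3) brandt_inverse_Pair_elem[of m p "g (Pair_elem j i)"] by simp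
qed

text \<open>Adding a constant (p, q) on the right annihilates every value of \<open>g\<close>
  outside column \<open>p\<close> and moves the others to column \<open>q\<close>. If
  \<open>g\<close> fixes \<vartheta>, the arguments sent into column \<open>p\<close> must
  themselves share a column.\<close>

lemma affine_map_cases:
  assumes "f \<in> affine_maps n"
  shows "constant_on_brandt n f \<or> column_map n f"
proof -
  obtain g h where f: "f = bmap_add n g h" and g: "g \<in> brandt_endomorphisms n"
    and h: "h \<in> constant_maps n"
    using assms by (auto simp: affine_maps_def)
  obtain c where c: "c \<in> brandt_set n" "\<And>a. a \<in> brandt_set n \<Longrightarrow> h a = c"
    using h by (auto simp: constant_maps_def)
  have hom: "g (a \<oplus>\<^sub>B b) = g a \<oplus>\<^sub>B g b" if "a \<in> brandt_set n" "b \<in> brandt_set n" for a b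
    using g that by (auto simp: brandt_endomorphisms_def)
  have fa: "f a = g a \<oplus>\<^sub>B c" if "a \<in> brandt_set n" for a
    using that by (simp add: f c)
  have gmaps: "g \<in> brandt_maps n"
    using g by (simp add: brandt_endomorphisms_def)
  show ?thesis
  proof (cases "g \<vartheta> = \<vartheta>")
    case False
    have "f a = g \<vartheta> \<oplus>\<^sub>B c" if "a \<in> brandt_set n" for a
      using fa[OF that] brandt_endomorphism_constant[OF g False that] by argo
    moreover have "g \<vartheta> \<oplus>\<^sub>B c \<in> brandt_set n"
      using brandt_maps_apply[OF gmaps] c(1) by (simp add: brandt_add_in_brandt_set)
    ultimately show ?thesis by (auto simp: constant_on_brandt_def)
  next
    case True
    \<comment> \<open>Otherwise (i, j) + (j', i') is \<vartheta>, which \<open>g\<close> fixes,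
      while its image (m, p) + (p, m') = (m, m') is nonzero.\<close>
    have eq: "j = j'" if "Pair_elem i j \<in> brandt_set n" "Pair_elem i' j' \<in> brandt_set n"
      "g (Pair_elem i j) = Pair_elem m p" "g (Pair_elem i' j') = Pair_elem m' p" for i j i' j' m m' p
    proof (rule ccontr)
      assume "j \<noteq> j'"
      have "g (Pair_elem j' i') = Pair_elem p m'"
        using brandt_endomorphism_swap[OF g] that by blast
      then have "g (Pair_elem i j \<oplus>\<^sub>B Pair_elem j' i') = Pair_elem m m'"
        using that by (subst hom) auto
      then show False using \<open>j \<noteq> j'\<close> True by simp
    qed
    show ?thesis
    \<comment> \<open>A support point is what fixes the column \<open>k\<close> and shows that
      \<open>c\<close> is a pair.\<close>
    proof (cases "\<exists>b\<in>brandt_set n. f b \<noteq> \<vartheta>")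
      case False
      then show ?thesis by (auto simp: constant_on_brandt_def)
    next
      case nonzero: True
      have shape: "\<exists>i j m p q. a = Pair_elem i j \<and> g a = Pair_elem m p \<and> c = Pair_elem p q
          \<and> f a = Pair_elem m q" if "a \<in> brandt_set n" "f a \<noteq> \<vartheta>" for a
        using that fa[OF that(1)] True by (cases a; cases "g a"; cases c) (auto split: if_splits)
      obtain b where "b \<in> brandt_set n" "f b \<noteq> \<vartheta>"
        using nonzero by blast
      with shape obtain i0 k m0 p q where b: "Pair_elem i0 k \<in> brandt_set n"
        "g (Pair_elem i0 k) = Pair_elem m0 p" and cpq: "c = Pair_elem p q"
        by blast
      have "column_map n f"
      proof (rule column_mapI)
        fix a
        assume a: "a \<in> brandt_set n" "f a \<noteq> \<vartheta>"
        then obtain i j m where "a = Pair_elem i j" "g a = Pair_elem m p" "f a = Pair_elem m q"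
          using shape[of a] cpq by auto
        then show "\<exists>i m. a = Pair_elem i k \<and> f a = Pair_elem m q"
          using eq[of i j i0 k m p m0] a(1) b by blast
      next
        fix i j m
        assume i: "Pair_elem i k \<in> brandt_set n" "f (Pair_elem i k) = Pair_elem m q"
          and j: "Pair_elem j k \<in> brandt_set n" "f (Pair_elem j k) = Pair_elem m q"
        have "g (Pair_elem i k) = Pair_elem m p" "g (Pair_elem j k) = Pair_elem m p"
          using i(2) j(2) fa[OF i(1)] fa[OF j(1)] cpq by (auto simp: brandt_add_eq_Pair_elem_iff)
        \<comment> \<open>Swapping turns rows of arguments into columns, so \<open>eq\<close> also
          gives injectivity: (k, i) and (k, j) are both sent to (p, m).\<close>
        then have "g (Pair_elem k i) = Pair_elem p m" "g (Pair_elem k j) = Pair_elem p m"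
          using brandt_endomorphism_swap[OF g i(1)] brandt_endomorphism_swap[OF g j(1)] by blast+
        then show "i = j"
          using i(1) j(1) by (intro eq[of k i k j p m p]) auto
      qed
      then show ?thesis ..
    qed
  qed
qed

section \<open>Closure of the dichotomy under addition and composition\<close>

lemma bmap_add_cases:
  assumes f: "constant_on_brandt n f \<or> column_map n f"
    and g: "constant_on_brandt n g \<or> column_map n g"
  shows "constant_on_brandt n (bmap_add n f g) \<or> column_map n (bmap_add n f g)"
proof (cases "constant_on_brandt n f")
  case True
  then obtain c where c: "c \<in> brandt_set n" "\<And>a. a \<in> brandt_set n \<Longrightarrow> f a = c"
    by (auto simp: constant_on_brandt_def)
  from g show ?thesis
  proof
    assume "constant_on_brandt n g"
    then show ?thesis
      using c by (auto simp: constant_on_brandt_def brandt_add_in_brandt_set)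
  next
    assume "column_map n g"
    then obtain k p where k:
      "\<And>a. a \<in> brandt_set n \<Longrightarrow> g a \<noteq> \<vartheta> \<Longrightarrow> \<exists>i m. a = Pair_elem i k \<and> g a = Pair_elem m p"
      and inj: "\<And>a b. a \<in> brandt_set n \<Longrightarrow> b \<in> brandt_set n \<Longrightarrow> g a \<noteq> \<vartheta> \<Longrightarrow> g a = g b \<Longrightarrow> a = b"
      by (rule column_mapE) blast
    \<comment> \<open>A constant (r, s) on the left survives only where \<open>g\<close> takes the
      value (s, p). Injectivity of \<open>g\<close> leaves at most one such point, and the sum there
      is (r, p).\<close>
    have "column_map n (bmap_add n f g)"
    proof (rule column_mapI)
      fix a
      assume a: "a \<in> brandt_set n" "bmap_add n f g a \<noteq> \<vartheta>"
      then have "g a \<noteq> \<vartheta>" by auto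
      with k a c show "\<exists>i m. a = Pair_elem i k \<and> bmap_add n f g a = Pair_elem m p"
        by (cases c) (fastforce split: if_splits)+
    next
      fix i j m
      assume "Pair_elem i k \<in> brandt_set n" "bmap_add n f g (Pair_elem i k) = Pair_elem m p"
        and "Pair_elem j k \<in> brandt_set n" "bmap_add n f g (Pair_elem j k) = Pair_elem m p"
      then show "i = j"
        using inj[of "Pair_elem i k" "Pair_elem j k"] c
        by (auto simp: brandt_add_eq_Pair_elem_iff simp del: Pair_elem_in_brandt_set)
    qed
    then show ?thesis ..
  qed
next
  case False
  then have "column_map n f" using f by blast
  then obtain k p where k:
    "\<And>a. a \<in> brandt_set n \<Longrightarrow> f a \<noteq> \<vartheta> \<Longrightarrow> \<exists>i m. a = Pair_elem i k \<and> f a = Pair_elem m p"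
    and inj: "\<And>a b. a \<in> brandt_set n \<Longrightarrow> b \<in> brandt_set n \<Longrightarrow> f a \<noteq> \<vartheta> \<Longrightarrow> f a = f b \<Longrightarrow> a = b"
    by (rule column_mapE) blast
  \<comment> \<open>From here on the right summand matters only through the column of its nonzero
    values, which constants and column maps both have; for the constant \<vartheta> any
    \<open>q\<close> will do.\<close>
  obtain q where q: "\<And>a. a \<in> brandt_set n \<Longrightarrow> g a \<noteq> \<vartheta> \<Longrightarrow> \<exists>m. g a = Pair_elem m q"
    using g
  proof
    assume "constant_on_brandt n g"
    then obtain c where c: "\<And>a. a \<in> brandt_set n \<Longrightarrow> g a = c"
      by (auto simp: constant_on_brandt_def)
    then show thesis
      by (cases c) (auto intro: that)
  next
    assume "column_map n g"
    then show thesis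
      by (rule column_mapE) (metis that)
  qed
  have "column_map n (bmap_add n f g)"
  proof (rule column_mapI)
    fix a
    assume a: "a \<in> brandt_set n" "bmap_add n f g a \<noteq> \<vartheta>"
    then have "f a \<noteq> \<vartheta>" "g a \<noteq> \<vartheta>" by auto
    with a k[of a] q[of a] show "\<exists>i m. a = Pair_elem i k \<and> bmap_add n f g a = Pair_elem m q"
      by (auto split: if_splits)
  next
    fix i j m
    assume i: "Pair_elem i k \<in> brandt_set n" "bmap_add n f g (Pair_elem i k) = Pair_elem m q"
      and j: "Pair_elem j k \<in> brandt_set n" "bmap_add n f g (Pair_elem j k) = Pair_elem m q"
    \<comment> \<open>A sum keeps the first coordinate of its left summand. Both values of
      \<open>f\<close> lie in column \<open>p\<close>, so equal first coordinates make them
      equal.\<close>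
    then obtain u v where "f (Pair_elem i k) = Pair_elem m u" "f (Pair_elem j k) = Pair_elem m v"
      by (auto simp: brandt_add_eq_Pair_elem_iff simp del: Pair_elem_in_brandt_set)
    then show "i = j"
      using k[OF i(1)] k[OF j(1)] inj[OF i(1) j(1)] by auto
  qed
  then show ?thesis ..
qed

lemma bmap_comp_cases:
  assumes f: "constant_on_brandt n f \<or> column_map n f"
    and g: "constant_on_brandt n g \<or> column_map n g"
    and maps: "f \<in> brandt_maps n" "g \<in> brandt_maps n"
  shows "constant_on_brandt n (bmap_comp n f g) \<or> column_map n (bmap_comp n f g)"
proof (cases "constant_on_brandt n f \<or> constant_on_brandt n g")
  case True
  then show ?thesis
    using maps by (auto simp: constant_on_brandt_def brandt_maps_apply)
next
  case False
  then have "column_map n f" and colg: "column_map n g" using f g by blast+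
  then obtain k p where k:
    "\<And>a. a \<in> brandt_set n \<Longrightarrow> f a \<noteq> \<vartheta> \<Longrightarrow> \<exists>i m. a = Pair_elem i k \<and> f a = Pair_elem m p"
    and injf: "\<And>a b. a \<in> brandt_set n \<Longrightarrow> b \<in> brandt_set n \<Longrightarrow> f a \<noteq> \<vartheta> \<Longrightarrow> f a = f b \<Longrightarrow> a = b"
    by (metis column_mapE)
  from colg obtain l q where l:
    "\<And>a. a \<in> brandt_set n \<Longrightarrow> g a \<noteq> \<vartheta> \<Longrightarrow> \<exists>i m. a = Pair_elem i l \<and> g a = Pair_elem m q"
    and injg: "\<And>a b. a \<in> brandt_set n \<Longrightarrow> b \<in> brandt_set n \<Longrightarrow> g a \<noteq> \<vartheta> \<Longrightarrow> g a = g b \<Longrightarrow> a = b"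
    by (rule column_mapE) blast
  \<comment> \<open>A column map sends \<vartheta> to \<vartheta>, because its support consists of
    pairs. So the support of the composite lies inside that of \<open>f\<close>.\<close>
  have ne: "f a \<noteq> \<vartheta>" if "a \<in> brandt_set n" "g (f a) \<noteq> \<vartheta>" for a
    using l[of \<vartheta>] that by auto
  have "column_map n (bmap_comp n f g)"
  proof (rule column_mapI)
    fix a
    assume a: "a \<in> brandt_set n" "bmap_comp n f g a \<noteq> \<vartheta>"
    then show "\<exists>i m. a = Pair_elem i k \<and> bmap_comp n f g a = Pair_elem m q"
      using k[of a] l[of "f a"] ne[of a] brandt_maps_apply[OF maps(1)] by auto
  next
    fix i j m
    assume i: "Pair_elem i k \<in> brandt_set n" "bmap_comp n f g (Pair_elem i k) = Pair_elem m q"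
      and j: "Pair_elem j k \<in> brandt_set n" "bmap_comp n f g (Pair_elem j k) = Pair_elem m q"
    then have "f (Pair_elem i k) = f (Pair_elem j k)"
      using injg[of "f (Pair_elem i k)" "f (Pair_elem j k)"] brandt_maps_apply[OF maps(1)]
      by (simp del: Pair_elem_in_brandt_set)
    then show "i = j"
      using injf[OF i(1) j(1)] ne[OF i(1)] i by (simp del: Pair_elem_in_brandt_set)
  qed
  then show ?thesis ..
qed

lemma affine_near_semiring_cases:
  "f \<in> affine_near_semiring n \<Longrightarrow> constant_on_brandt n f \<or> column_map n f"
proof (induction rule: affine_near_semiring.induct)
  case (affine f)
  then show ?case by (rule affine_map_cases)
next
  case (add f g)
  then show ?case by (intro bmap_add_cases)
next
  case (comp f g)
  then show ?case by (intro bmap_comp_cases affine_near_semiring_in_brandt_maps)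
qed

section \<open>Regular elements and their inverses\<close>

lemma regular_cases:
  assumes "f \<in> affine_near_semiring n" "y \<in> affine_near_semiring n"
    and reg: "bmap_add n (bmap_add n f y) f = f"
  shows "constant_on_brandt n f \<or> support_subsingleton n f"
proof (cases "constant_on_brandt n f")
  case False
  then have "column_map n f" using affine_near_semiring_cases[OF assms(1)] by blast
  then obtain k p where k:
    "\<And>a. a \<in> brandt_set n \<Longrightarrow> f a \<noteq> \<vartheta> \<Longrightarrow> \<exists>i m. a = Pair_elem i k \<and> f a = Pair_elem m p"
    and inj: "\<And>a b. a \<in> brandt_set n \<Longrightarrow> b \<in> brandt_set n \<Longrightarrow> f a \<noteq> \<vartheta> \<Longrightarrow> f a = f b \<Longrightarrow> a = b"
    by (rule column_mapE) blast
  \<comment> \<open>The regularity equation evaluated at a support point determines \<open>y\<close>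
    there.\<close>
  have yval: "y a = Pair_elem p m" if "a \<in> brandt_set n" "f a = Pair_elem m p" for a m
    using fun_cong[OF reg, of a] that by (simp add: brandt_inverse_Pair_elem)
  have "a = b" if a: "a \<in> brandt_set n" "f a \<noteq> \<vartheta>" and b: "b \<in> brandt_set n" "f b \<noteq> \<vartheta>" for a b
  proof -
    obtain m m' where m: "f a = Pair_elem m p" "f b = Pair_elem m' p"
      using k a b by meson
    then have y: "y a = Pair_elem p m" "y b = Pair_elem p m'"
      using yval a b by auto
    \<comment> \<open>The values (p, m) and (p, m') of \<open>y\<close> have second coordinates
      \<open>m\<close> and \<open>m'\<close>. These agree whether \<open>y\<close> is constant or
      has all its nonzero values in one column.\<close>
    from affine_near_semiring_cases[OF assms(2)] have "m = m'"
    proof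
      assume "constant_on_brandt n y"
      then show ?thesis using y a b by (auto simp: constant_on_brandt_def)
    next
      assume "column_map n y"
      then obtain k' q where
        "\<And>a. a \<in> brandt_set n \<Longrightarrow> y a \<noteq> \<vartheta> \<Longrightarrow> \<exists>i m. a = Pair_elem i k' \<and> y a = Pair_elem m q"
        by (rule column_mapE) blast
      from this[of a] this[of b] show ?thesis using y a b by auto
    qed
    then show "a = b" using inj m a b by simp
  qed
  then show ?thesis by (auto simp: support_subsingleton_def)
qed simp

lemma inverse_exists:
  assumes f: "f \<in> affine_near_semiring n"
    and cases: "constant_on_brandt n f \<or> support_subsingleton n f"
  shows "\<exists>y\<in>affine_near_semiring n.
    bmap_add n (bmap_add n f y) f = f \<and> bmap_add n (bmap_add n y f) y = y"
proof (cases "\<exists>a\<in>brandt_set n. f a \<noteq> \<vartheta>")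
  case False
  \<comment> \<open>Here \<open>f\<close> is the zero map and is its own inverse.\<close>
  have "bmap_add n (bmap_add n f f) f = f"
    using f False by (intro brandt_maps_eqI[of _ n])
      (auto intro: bmap_add_in_brandt_maps affine_near_semiring_in_brandt_maps)
  then show ?thesis using f by blast
next
  case True
  then obtain a k l where a: "a \<in> brandt_set n" "f a = Pair_elem k l"
    by (metis brandt.exhaust)
  \<comment> \<open>Both shapes allow only one nonzero value, so one constant can invert it at all
    arguments simultaneously.\<close>
  have fval: "f b = Pair_elem k l \<or> f b = \<vartheta>" if "b \<in> brandt_set n" for b
    using cases a that by (auto simp: constant_on_brandt_def support_subsingleton_def)
  have "f a \<in> brandt_set n"
    using f a(1) affine_near_semiring_in_brandt_maps brandt_maps_apply by blast
  then have lk: "Pair_elem l k \<in> brandt_set n" using a by simp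
  let ?c = "\<lambda>a\<in>brandt_set n. Pair_elem l k"
  \<comment> \<open>Where \<open>f\<close> is (k, l) this is (l, k) + (k, l) + (l, k) = (l, k);
    elsewhere it is \<vartheta>. Sandwiching \<open>f\<close> between constants keeps its support
    and stays inside the near-semiring.\<close>
  let ?y = "bmap_add n (bmap_add n ?c f) ?c"
  have y: "?y \<in> affine_near_semiring n"
    by (intro affine_near_semiring.add f constant_map_in_affine_near_semiring lk)
  have "bmap_add n (bmap_add n f ?y) f = f"
  proof (rule brandt_maps_eqI[of _ n])
    fix b assume "b \<in> brandt_set n"
    then show "bmap_add n (bmap_add n f ?y) f b = f b" using fval[of b] by auto
  qed (intro bmap_add_in_brandt_maps affine_near_semiring_in_brandt_maps f y)+
  moreover have "bmap_add n (bmap_add n ?y f) ?y = ?y"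
  proof (rule brandt_maps_eqI[of _ n])
    fix b assume "b \<in> brandt_set n"
    then show "bmap_add n (bmap_add n ?y f) ?y b = ?y b" using fval[of b] by auto
  qed (intro bmap_add_in_brandt_maps affine_near_semiring_in_brandt_maps f y)+
  ultimately show ?thesis using y by blast
qed

lemma regular_elements_iff:
  "f \<in> regular_elements (affine_near_semiring n) (bmap_add n) \<longleftrightarrow>
    f \<in> affine_near_semiring n \<and> (constant_on_brandt n f \<or> support_subsingleton n f)"
  using regular_cases inverse_exists unfolding regular_elements_def by blast

section \<open>The inverse semigroup of regular elements\<close>

lemma constant_or_support_subsingleton_add:
  assumes "constant_on_brandt n f \<or> support_subsingleton n f"
    and "constant_on_brandt n g \<or> support_subsingleton n g"
  shows "constant_on_brandt n (bmap_add n f g) \<or> support_subsingleton n (bmap_add n f g)"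
proof (cases "constant_on_brandt n f \<and> constant_on_brandt n g")
  case True
  then show ?thesis by (auto simp: constant_on_brandt_def brandt_add_in_brandt_set)
next
  case False
  \<comment> \<open>The support of a sum lies in both supports, and one of them now has at most one
    point.\<close>
  have "f a \<noteq> \<vartheta> \<and> g a \<noteq> \<vartheta>" if "a \<in> brandt_set n" "bmap_add n f g a \<noteq> \<vartheta>" for a
    using that by auto
  then show ?thesis
    using False assms unfolding support_subsingleton_def by metis
qed

theorem theorem3p15:
  fixes n :: nat
  assumes "n \<ge> 2"
  shows "inverse_semigroup (regular_elements (affine_near_semiring n) (bmap_add n)) (bmap_add n)"
proof -
  let ?A = "affine_near_semiring n"
  let ?K = "regular_elements ?A (bmap_add n)"
  have "(\<lambda>a\<in>brandt_set n. \<vartheta>) \<in> ?K"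
    using constant_map_in_affine_near_semiring[of \<vartheta> n]
    by (auto simp: regular_elements_iff constant_on_brandt_def)
  moreover have "bmap_add n f g \<in> ?K" if "f \<in> ?K" "g \<in> ?K" for f g
    using that constant_or_support_subsingleton_add
    by (auto simp: regular_elements_iff intro: affine_near_semiring.add)
  ultimately have "semigroup_on ?K (bmap_add n)"
    by (auto simp: semigroup_on_def bmap_add_assoc)
  moreover have "\<exists>!y. y \<in> ?K \<and> bmap_add n (bmap_add n f y) f = f \<and> bmap_add n (bmap_add n y f) y = y"
    if f: "f \<in> ?K" for f
  proof (rule ex_ex1I)
    obtain y where y: "y \<in> ?A" "bmap_add n (bmap_add n f y) f = f"
      "bmap_add n (bmap_add n y f) y = y"
      using f inverse_exists unfolding regular_elements_iff by blast
    \<comment> \<open>The second inverse equation makes \<open>f\<close> a witness for the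
      regularity of \<open>y\<close>.\<close>
    then have "y \<in> ?K"
      using f by (auto simp: regular_elements_def)
    with y show "\<exists>y. y \<in> ?K \<and> bmap_add n (bmap_add n f y) f = f \<and> bmap_add n (bmap_add n y f) y = y"
      by blast
  next
    fix y z
    assume y: "y \<in> ?K \<and> bmap_add n (bmap_add n f y) f = f \<and> bmap_add n (bmap_add n y f) y = y"
      and z: "z \<in> ?K \<and> bmap_add n (bmap_add n f z) f = f \<and> bmap_add n (bmap_add n z f) z = z"
    show "y = z"
    \<comment> \<open>Extensionality reduces uniqueness to each argument, where inverses in the
      Brandt semigroup are unique.\<close>
    proof (rule brandt_maps_eqI[of _ n])
      fix a assume a: "a \<in> brandt_set n"
      have eq: "u a \<oplus>\<^sub>B v a \<oplus>\<^sub>B u a = u a" if "bmap_add n (bmap_add n u v) u = u" for u v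
        using fun_cong[OF that, of a] a by simp
      show "y a = z a"
        using y z eq[of f y] eq[of y f] eq[of f z] eq[of z f]
        by (intro brandt_inverse_unique[of "f a" "y a" "z a"]) blast+
    qed (use y z in \<open>auto simp: regular_elements_iff intro: affine_near_semiring_in_brandt_maps\<close>)
  qed
  ultimately show ?thesis
    by (simp add: inverse_semigroup_def)
qed

end
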